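(* Let $f:\mathbb{Z}^n\to\mathbb{R}\cup\{+\infty\}$. (1) If $f$ is ${\rm L}^{\natural}$-convex, then $f$ is globally discrete midpoint convex. (2) If $f$ is globally discrete midpoint convex, then $f$ is locally discrete midpoint convex. (3) If $f$ is locally discrete midpoint convex, then $f$ is integrally convex.
   Context: For $x\in\mathbb{R}^n$, $\lceil x\rceil$ and $\lfloor x\rfloor$ denote the integer vectors obtained by rounding each component up, respectively down. The effective domain of $f$ is $\operatorname{dom} f=\{x\in\mathbb{Z}^n\mid f(x)<+\infty\}$. A set $S\subseteq\mathbb{Z}^n$ is discrete midpoint convex if for all $x,y\in S$ with $\|x-y\|_\infty\ge2$ both $\lceil (x+y)/2\rceil$ and $\lfloor (x+y)/2\rfloor$ belong to $S$. Discrete midpoint convexity inequality for a pair $(x,y)$: $f(x)+f(y)\ge f(\lceil (x+y)/2\rceil)+f(\lfloor (x+y)/2\rfloor)$. $f$ is globally discrete midpoint convex if this inequality holds for all $x,y\in\mathbb{Z}^n$ with $\|x-y\|_\infty\ge2$. $f$ is locally discrete midpoint convex if $\operatorname{dom} f$ is a discrete midpoint convex set and the inequality holds for all $x,y\in\mathbb{Z}^n$ with $\|x-y\|_\infty=2$. $f$ is ${\rm L}^{\natural}$-convex if $f(x)+f(y)\ge f((x-\mu\mathbf{1})\vee y)+f(x\wedge(y+\mu\mathbf{1}))$ for all $x,y\in\mathbb{Z}^n$ and all nonnegative integers $\mu$, where $\mathbf{1}=(1,\ldots,1)$ and $\vee,\wedge$ denote componentwise maximum and minimum. (It is a known result that this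 is equivalent to the discrete midpoint convexity inequality holding for all $x,y\in\mathbb{Z}^n$.) For $x\in\mathbb{R}^n$ let $N(x)=\{z\in\mathbb{Z}^n\mid |x_i-z_i|<1\ (i=1,\ldots,n)\}$ and $$\tilde f(x)=\min\Big\{\sum_{z\in N(x)}\lambda_zf(z)\ \Big|\ \sum_{z\in N(x)}\lambda_zz=x,\ \sum_{z\in N(x)}\lambda_z=1,\ \lambda_z\ge0\Big\}$$ (with $0\cdot(+\infty)=0$). $f$ is integrally convex if $\tilde f:\mathbb{R}^n\to\mathbb{R}\cup\{+\infty\}$ is convex on $\mathbb{R}^n$. *)

theory Defs
  imports "HOL-Analysis.Analysis"
begin

text \<open>
  The lattice of integer points is the type \<open>int ^ 'n\<close>, with \<open>'n\<close> an arbitrary finite index type.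
  Functions with values in the reals extended by plus infinity are functions into \<open>ereal\<close>
  that never take the value minus infinity; this is an explicit hypothesis wherever it is needed.
\<close>

definition real_vec :: "int ^ 'n \<Rightarrow> real ^ 'n"
  where "real_vec z = (\<chi> i. real_of_int (z $ i))"

definition vec_ceiling :: "real ^ 'n \<Rightarrow> int ^ 'n"
  where "vec_ceiling x = (\<chi> i. \<lceil>x $ i\<rceil>)"

definition vec_floor :: "real ^ 'n \<Rightarrow> int ^ 'n"
  where "vec_floor x = (\<chi> i. \<lfloor>x $ i\<rfloor>)"

definition vec_max :: "int ^ 'n \<Rightarrow> int ^ 'n \<Rightarrow> int ^ 'n"
  where "vec_max x y = (\<chi> i. max (x $ i) (y $ i))"

definition vec_min :: "int ^ 'n \<Rightarrow> int ^ 'n \<Rightarrow> int ^ 'n"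
  where "vec_min x y = (\<chi> i. min (x $ i) (y $ i))"

definition dist_inf :: "int ^ 'n \<Rightarrow> int ^ 'n \<Rightarrow> real"
  where "dist_inf x y = infnorm (real_vec x - real_vec y)"

definition upper_midpoint :: "int ^ 'n \<Rightarrow> int ^ 'n \<Rightarrow> int ^ 'n"
  where "upper_midpoint x y = vec_ceiling ((real_vec x + real_vec y) /\<^sub>R 2)"

definition lower_midpoint :: "int ^ 'n \<Rightarrow> int ^ 'n \<Rightarrow> int ^ 'n"
  where "lower_midpoint x y = vec_floor ((real_vec x + real_vec y) /\<^sub>R 2)"

definition eff_dom :: "(int ^ 'n \<Rightarrow> ereal) \<Rightarrow> (int ^ 'n) set"
  where "eff_dom f = {x. f x < \<infinity>}"

definition discrete_midpoint_convex_set :: "(int ^ 'n) set \<Rightarrow> bool"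
  where "discrete_midpoint_convex_set S \<longleftrightarrow>
    (\<forall>x\<in>S. \<forall>y\<in>S. dist_inf x y \<ge> 2 \<longrightarrow> upper_midpoint x y \<in> S \<and> lower_midpoint x y \<in> S)"

definition discrete_midpoint_ineq :: "(int ^ 'n \<Rightarrow> ereal) \<Rightarrow> int ^ 'n \<Rightarrow> int ^ 'n \<Rightarrow> bool"
  where "discrete_midpoint_ineq f x y \<longleftrightarrow>
    f x + f y \<ge> f (upper_midpoint x y) + f (lower_midpoint x y)"

definition globally_discrete_midpoint_convex :: "(int ^ 'n \<Rightarrow> ereal) \<Rightarrow> bool"
  where "globally_discrete_midpoint_convex f \<longleftrightarrow>
    (\<forall>x y. dist_inf x y \<ge> 2 \<longrightarrow> discrete_midpoint_ineq f x y)"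

definition locally_discrete_midpoint_convex :: "(int ^ 'n \<Rightarrow> ereal) \<Rightarrow> bool"
  where "locally_discrete_midpoint_convex f \<longleftrightarrow>
    discrete_midpoint_convex_set (eff_dom f) \<and>
    (\<forall>x y. dist_inf x y = 2 \<longrightarrow> discrete_midpoint_ineq f x y)"

definition L_natural_convex :: "(int ^ 'n \<Rightarrow> ereal) \<Rightarrow> bool"
  where "L_natural_convex f \<longleftrightarrow>
    (\<forall>x y. \<forall>\<mu>::int. \<mu> \<ge> 0 \<longrightarrow>
      f x + f y \<ge> f (vec_max (x - \<mu> *s 1) y) + f (vec_min x (y + \<mu> *s 1)))"

definition int_nbhd :: "real ^ 'n \<Rightarrow> (int ^ 'n) set"
  where "int_nbhd x = {z. \<forall>i. \<bar>x $ i - real_of_int (z $ i)\<bar> < 1}"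

definition nbhd_coeffs :: "real ^ 'n \<Rightarrow> (int ^ 'n \<Rightarrow> real) set"
  where "nbhd_coeffs x = {c. (\<Sum>z\<in>int_nbhd x. c z *\<^sub>R real_vec z) = x \<and>
    (\<Sum>z\<in>int_nbhd x. c z) = 1 \<and> (\<forall>z\<in>int_nbhd x. c z \<ge> 0)}"

text \<open>
  The infimum below is a minimum when \<open>f\<close> avoids minus infinity: \<open>int_nbhd x\<close> is finite, \<open>x\<close> lies
  in its convex hull, and the coefficients restricted to \<open>int_nbhd x\<close> form a compact polytope.
  In \<open>ereal\<close>, \<open>0 * \<infinity> = 0\<close>.
\<close>

definition local_convex_ext :: "(int ^ 'n \<Rightarrow> ereal) \<Rightarrow> real ^ 'n \<Rightarrow> ereal"
  where "local_convex_ext f x = (INF c\<in>nbhd_coeffs x. \<Sum>z\<in>int_nbhd x. ereal (c z) * f z)"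

text \<open>The library's \<open>convex_on\<close> only covers real-valued functions.\<close>

definition ereal_convex :: "('a::real_vector \<Rightarrow> ereal) \<Rightarrow> bool"
  where "ereal_convex g \<longleftrightarrow>
    (\<forall>x y. \<forall>u\<ge>0. \<forall>v\<ge>0. u + v = 1 \<longrightarrow>
      g (u *\<^sub>R x + v *\<^sub>R y) \<le> ereal u * g x + ereal v * g y)"

definition integrally_convex :: "(int ^ 'n \<Rightarrow> ereal) \<Rightarrow> bool"
  where "integrally_convex f \<longleftrightarrow> ereal_convex (local_convex_ext f)"

end

theory Submission
  imports Defs
begin

text \<open>
  The first implication compares the pair \<open>x \<ge> y\<close> with the two points of the translation inequality
  for \<open>\<mu> = m - 1\<close>, where \<open>m\<close> is the largest component of \<open>x - y\<close>. Up to order, the new pair has the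
  same sum, and the components of the difference equal to \<open>m\<close> are reflected to \<open>m - 2\<close>. Iterating,
  all components of the difference end in \<open>{0, 1}\<close>, and then the pair consists of the two rounded
  midpoints. The case \<open>\<mu> = 0\<close> makes an arbitrary pair comparable. The second implication only uses
  that a finite sum of values above minus infinity has finite summands.

  The third implication rests on an exchange property
  (\<open>locally_discrete_midpoint_convex_exchange\<close>): if \<open>x, y\<close> lie in the effective domain at distance
  \<open>m \<ge> 2\<close>, and \<open>p\<close> arises from \<open>x\<close> by a single unit step towards \<open>y\<close> in a suitable set of
  coordinates (\<open>step_toward\<close>), then \<open>f p + f (x + y - p) \<le> f x + f y\<close>. For \<open>m = 2\<close> this is the
  midpoint inequality itself. For larger \<open>m\<close>, let \<open>y'\<close> be \<open>y\<close> moved one step towards \<open>x\<close>. The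
  inequality for \<open>(x, y')\<close>, at distance \<open>m - 1\<close>, and the midpoint inequality for \<open>(x + y' - p, y)\<close>,
  at distance \<open>2\<close>, add up to the one for \<open>(x, y)\<close>. To cancel the common terms they must be finite,
  that is, \<open>y'\<close> must lie in the effective domain; this is where midpoint convexity of the domain at
  all distances is needed (\<open>step_toward_mem\<close>).

  Integral convexity then follows by a minimisation. Write a point \<open>p\<close> as a convex combination of
  points of the effective domain and choose, among the combinations supported in a large box, one
  of least \<open>f\<close>-cost and, among those, one of least mean square norm. If two points of its support
  had distance at least \<open>2\<close>, the exchange property would move some of their weight to a pair with
  the same sum, no larger \<open>f\<close>-cost and strictly smaller square norm. Hence any two points of the
  support differ by at most one in each coordinate, which forces the support into the integral
  neighbourhood of \<open>p\<close>. So \<open>local_convex_ext f\<close> is bounded by the cost of every convex combination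
  (\<open>local_convex_ext_le_combination\<close>), and convexity follows by mixing combinations for \<open>x\<close> and \<open>y\<close>.
\<close>

section \<open>Distances and rounded midpoints in coordinates\<close>

lemma real_vec_nth [simp]: "real_vec z $ i = real_of_int (z $ i)"
  by (simp add: real_vec_def)

lemma real_vec_add: "real_vec (x + y) = real_vec x + real_vec y"
  by (simp add: vec_eq_iff)

lemma dist_inf_eq_Max:
  fixes x y :: "int ^ 'n"
  shows "dist_inf x y = Max (range (\<lambda>i. real_of_int \<bar>x $ i - y $ i\<bar>))"
proof -
  have eq: "{\<bar>(real_vec x - real_vec y) $ i\<bar> |i. i \<in> UNIV}
      = range (\<lambda>i. real_of_int \<bar>x $ i - y $ i\<bar>)"
    by auto
  show ?thesis
    unfolding dist_inf_def infnorm_cart eq by (rule cSup_eq_Max) auto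
qed

lemma dist_inf_ge_iff: "real_of_int m \<le> dist_inf x y \<longleftrightarrow> (\<exists>i. m \<le> \<bar>x $ i - y $ i\<bar>)"
  unfolding dist_inf_eq_Max by (subst Max_ge_iff) (auto simp flip: of_int_abs of_int_diff)

lemma dist_inf_eq_iff:
  "dist_inf x y = real_of_int m \<longleftrightarrow>
    (\<forall>i. \<bar>x $ i - y $ i\<bar> \<le> m) \<and> (\<exists>i. \<bar>x $ i - y $ i\<bar> = m)"
  unfolding dist_inf_eq_Max
  by (subst Max_eq_iff) (auto simp: image_iff simp flip: of_int_abs of_int_diff)

lemma upper_midpoint_nth: "upper_midpoint x y $ i = (x $ i + y $ i + 1) div 2"
proof -
  have "upper_midpoint x y $ i = \<lceil>real_of_int (x $ i + y $ i) / real_of_int 2\<rceil>"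
    by (simp add: upper_midpoint_def vec_ceiling_def field_simps)
  also have "\<dots> = - (- (x $ i + y $ i) div 2)"
    by (rule ceiling_divide_eq_div)
  also have "\<dots> = (x $ i + y $ i + 1) div 2"
    by presburger
  finally show ?thesis .
qed

lemma lower_midpoint_nth: "lower_midpoint x y $ i = (x $ i + y $ i) div 2"
proof -
  have "lower_midpoint x y $ i = \<lfloor>real_of_int (x $ i + y $ i) / real_of_int 2\<rfloor>"
    by (simp add: lower_midpoint_def vec_floor_def field_simps)
  then show ?thesis
    by (simp only: floor_divide_of_int_eq)
qed

lemma upper_midpoint_bounds:
  "x $ i + y $ i \<le> 2 * upper_midpoint x y $ i" "2 * upper_midpoint x y $ i \<le> x $ i + y $ i + 1"
  unfolding upper_midpoint_nth by linarith+

lemma lower_midpoint_bounds: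
  "x $ i + y $ i - 1 \<le> 2 * lower_midpoint x y $ i" "2 * lower_midpoint x y $ i \<le> x $ i + y $ i"
  unfolding lower_midpoint_nth by linarith+

lemma discrete_midpoint_convex_setD:
  assumes "discrete_midpoint_convex_set S" "x \<in> S" "y \<in> S" "2 \<le> \<bar>x $ i - y $ i\<bar>"
  shows "upper_midpoint x y \<in> S" "lower_midpoint x y \<in> S"
  using assms dist_inf_ge_iff[of 2 x y] by (auto simp: discrete_midpoint_convex_set_def)

section \<open>Translation submodularity and midpoints\<close>

text \<open>
  With \<open>\<mu> = m - 1\<close> the translation inequality passes to a pair with the same sum in which the
  difference \<open>m\<close> has become \<open>m - 2\<close> and all other differences are kept. This is again an ordered
  pair, with differences at most \<open>m - 1\<close>, as long as \<open>m \<ge> 2\<close>.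
\<close>

lemma L_natural_convex_ordered_midpoint:
  fixes f :: "int ^ 'n \<Rightarrow> ereal"
  assumes f: "L_natural_convex f"
    and xy: "\<And>i. y $ i \<le> x $ i" "\<And>i. x $ i \<le> y $ i + int m"
  shows "f (upper_midpoint x y) + f (lower_midpoint x y) \<le> f x + f y"
  using xy
proof (induction m arbitrary: x y rule: less_induct)
  case (less m)
  show ?case
  proof (cases "m \<le> 1")
    case True
    have eq_or: "x $ i = y $ i \<or> x $ i = y $ i + 1" for i
      using less.prems[of i] True by linarith
    have "upper_midpoint x y $ i = x $ i \<and> lower_midpoint x y $ i = y $ i" for i
      unfolding upper_midpoint_nth lower_midpoint_nth using eq_or[of i] by presburger
    then have "upper_midpoint x y = x" "lower_midpoint x y = y"
      by (auto simp: vec_eq_iff)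
    then show ?thesis by simp
  next
    case False
    define \<mu> where "\<mu> = int m - 1"
    let ?a = "vec_max (x - \<mu> *s 1) y" and ?b = "vec_min x (y + \<mu> *s 1)"
    have a: "?a $ i = max (x $ i - \<mu>) (y $ i)" and b: "?b $ i = min (x $ i) (y $ i + \<mu>)" for i
      by (simp_all add: vec_max_def vec_min_def)
    \<comment> \<open>Coordinates at difference \<open>m\<close> move to \<open>x - (m - 1)\<close> and \<open>y + (m - 1)\<close>, and the others are
      swapped; so \<open>?b\<close> takes over the part of \<open>x\<close>, and the sum, hence both midpoints, are kept.\<close>
    have "upper_midpoint ?b ?a = upper_midpoint x y" "lower_midpoint ?b ?a = lower_midpoint x y"
      by (auto simp: vec_eq_iff upper_midpoint_nth lower_midpoint_nth a b max_def min_def)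
    moreover have "f (upper_midpoint ?b ?a) + f (lower_midpoint ?b ?a) \<le> f ?b + f ?a"
    proof (rule less.IH)
      show "m - 1 < m" using False by simp
      show "?a $ i \<le> ?b $ i" "?b $ i \<le> ?a $ i + int (m - 1)" for i
        using less.prems[of i] False unfolding a b by (auto simp: \<mu>_def of_nat_diff)
    qed
    moreover have "f ?a + f ?b \<le> f x + f y"
    proof -
      have "0 \<le> \<mu>" using False by (simp add: \<mu>_def)
      then show ?thesis using f unfolding L_natural_convex_def by blast
    qed
    ultimately show ?thesis by (simp add: add.commute)
  qed
qed

text \<open>The case \<open>\<mu> = 0\<close> is submodularity, which replaces any pair by a comparable one.\<close>

lemma L_natural_convex_midpoint:
  fixes f :: "int ^ 'n \<Rightarrow> ereal"
  assumes f: "L_natural_convex f"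
  shows "discrete_midpoint_ineq f x y"
proof -
  let ?a = "vec_max x y" and ?b = "vec_min x y"
  have a: "?a $ i = max (x $ i) (y $ i)" and b: "?b $ i = min (x $ i) (y $ i)" for i
    by (simp_all add: vec_max_def vec_min_def)
  define m where "m = (\<Sum>i\<in>UNIV. nat \<bar>x $ i - y $ i\<bar>)"
  have m: "nat \<bar>x $ i - y $ i\<bar> \<le> m" for i
    unfolding m_def by (rule member_le_sum) auto
  have "upper_midpoint ?a ?b = upper_midpoint x y" "lower_midpoint ?a ?b = lower_midpoint x y"
    by (auto simp: vec_eq_iff upper_midpoint_nth lower_midpoint_nth a b max_def min_def)
  moreover have "f (upper_midpoint ?a ?b) + f (lower_midpoint ?a ?b) \<le> f ?a + f ?b"
  proof (rule L_natural_convex_ordered_midpoint[OF f])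
    show "?b $ i \<le> ?a $ i" "?a $ i \<le> ?b $ i + int m" for i
      using m[of i] unfolding a b by auto
  qed
  moreover have "f ?a + f ?b \<le> f x + f y"
    using f[unfolded L_natural_convex_def, rule_format, of 0 x y] by simp
  ultimately show ?thesis by (simp add: discrete_midpoint_ineq_def)
qed

lemma globally_imp_locally_discrete_midpoint_convex:
  fixes f :: "int ^ 'n \<Rightarrow> ereal"
  assumes "\<And>x. f x \<noteq> -\<infinity>" and f: "globally_discrete_midpoint_convex f"
  shows "locally_discrete_midpoint_convex f"
  unfolding locally_discrete_midpoint_convex_def discrete_midpoint_convex_set_def
proof (intro conjI ballI allI impI)
  fix x y assume xy: "x \<in> eff_dom f" "y \<in> eff_dom f" "2 \<le> dist_inf x y"
  then have "f (upper_midpoint x y) + f (lower_midpoint x y) \<le> f x + f y"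
    using f by (auto simp: globally_discrete_midpoint_convex_def discrete_midpoint_ineq_def)
  also have "\<dots> < \<infinity>"
    using xy by (auto simp: eff_dom_def)
  finally show "upper_midpoint x y \<in> eff_dom f" "lower_midpoint x y \<in> eff_dom f"
    using assms(1) by (auto simp: eff_dom_def)
qed (use f in \<open>auto simp: globally_discrete_midpoint_convex_def\<close>)

section \<open>Unit steps inside discrete midpoint convex sets\<close>

definition decrease_toward :: "int ^ 'n \<Rightarrow> int ^ 'n \<Rightarrow> int ^ 'n"
  where "decrease_toward x y = (\<chi> i. if y $ i < x $ i then x $ i - 1 else x $ i)"

text \<open>
  Replacing \<open>y\<close> by the lower midpoint of \<open>x\<close> and \<open>y\<close> keeps the set of coordinates where \<open>y\<close> is
  below \<open>x\<close>, since a negative half rounds down to at least one. Iterating ends at differences in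
  \<open>{-1, 0}\<close>. The strict upper bound guarantees that positive differences have died out when the
  difference \<open>-m\<close> has shrunk to \<open>-1\<close>: it is preserved, because \<open>m - 1\<close> is halved to
  \<open>\<lceil>m / 2\<rceil> - 1\<close> at most. The attained value \<open>-m\<close> keeps the distance at least \<open>2\<close> until then.
\<close>

lemma decrease_toward_mem:
  fixes x y :: "int ^ 'n" and m :: int
  assumes S: "discrete_midpoint_convex_set S" and "x \<in> S" "y \<in> S"
    and "\<And>i. x $ i - m \<le> y $ i" "\<And>i. y $ i < x $ i + m" "y $ k = x $ k - m" "1 \<le> m"
  shows "decrease_toward x y \<in> S"
  using assms(3-)
proof (induction "nat m" arbitrary: m y rule: less_induct)
  case less
  note bnd = less.prems(2,3)
  show ?case
  proof (cases "m = 1")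
    case True
    have "decrease_toward x y $ i = y $ i" for i
      using bnd[of i] True by (auto simp: decrease_toward_def)
    then have "decrease_toward x y = y" by (simp add: vec_eq_iff)
    then show ?thesis using less.prems by simp
  next
    case False
    then have m: "m \<ge> 2" using less.prems by simp
    let ?y = "lower_midpoint x y"
    have "decrease_toward x ?y \<in> S"
    proof (rule less.hyps)
      show "nat ((m + 1) div 2) < nat m" "1 \<le> (m + 1) div 2"
        using m by linarith+
      show "?y \<in> S"
        using discrete_midpoint_convex_setD(2)[OF S \<open>x \<in> S\<close> less.prems(1), of k] less.prems m by simp
      show "x $ i - (m + 1) div 2 \<le> ?y $ i" "?y $ i < x $ i + (m + 1) div 2" for i
        using bnd[of i] unfolding lower_midpoint_nth by presburger+
      show "?y $ k = x $ k - (m + 1) div 2"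
        using less.prems(4) unfolding lower_midpoint_nth by presburger
    qed
    moreover have "decrease_toward x ?y = decrease_toward x y"
    proof -
      have "?y $ i < x $ i \<longleftrightarrow> y $ i < x $ i" for i
        unfolding lower_midpoint_nth by presburger
      then show ?thesis by (simp add: decrease_toward_def)
    qed
    ultimately show ?thesis by simp
  qed
qed

text \<open>
  The parameter \<open>m\<close> stands for the maximum distance of \<open>x\<close> and \<open>y\<close>. The asymmetry is that of the
  rounding: for \<open>m = 2\<close> the step leads from \<open>x\<close> to the upper midpoint, where a difference of \<open>-1\<close>
  is rounded to \<open>0\<close> and one of \<open>1\<close> to \<open>1\<close>.
\<close>

definition step_toward :: "int \<Rightarrow> int ^ 'n \<Rightarrow> int ^ 'n \<Rightarrow> int ^ 'n"
  where "step_toward m x y = (\<chi> i. if x $ i < y $ i then x $ i + 1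
    else if y $ i = x $ i - m then x $ i - 1 else x $ i)"

text \<open>
  The step from \<open>x\<close> towards \<open>y\<close> depends only on which differences are positive and which attain
  \<open>-m\<close>. So it suffices to find a point \<open>z\<close> of \<open>S\<close>, closer to \<open>x\<close>, for which these two sets of
  coordinates are the same. The upper midpoint works, with distance \<open>\<lceil>m / 2\<rceil>\<close>, except if \<open>m\<close> is
  odd and \<open>-m\<close> is attained: then \<open>-m\<close> and \<open>1 - m\<close> are halved to the same value. In that case one
  uses \<open>w = decrease_toward x y\<close> instead of \<open>x\<close>. The upper midpoint of \<open>w\<close> and \<open>y\<close> is the midpoint
  of \<open>x\<close> and \<open>y\<close> rounded away from \<open>x\<close> in every coordinate, and it separates \<open>-m\<close> from \<open>1 - m\<close>.
\<close>

lemma step_toward_mem: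
  fixes x y :: "int ^ 'n" and m :: int
  assumes S: "discrete_midpoint_convex_set S" and "x \<in> S" "y \<in> S"
    and "\<And>i. \<bar>y $ i - x $ i\<bar> \<le> m" "\<bar>y $ k - x $ k\<bar> = m" "1 \<le> m"
  shows "step_toward m x y \<in> S"
  using assms(3-)
proof (induction "nat m" arbitrary: m y k rule: less_induct)
  case less
  note bnd = less.prems(2)
  define h where "h = (m + 1) div 2"
  have h: "m \<le> 2 * h" "2 * h \<le> m + 1"
    unfolding h_def by linarith+
  have h_even: "2 * h = m" if "even m"
    using that unfolding h_def by presburger
  have h_odd: "2 * h = m + 1" if "odd m"
    using that unfolding h_def by presburger
  note upper = upper_midpoint_bounds[where x = x and y = y] and lower = lower_midpoint_bounds[where x = x and y = y]
  have reduce: "step_toward m x y \<in> S"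
    if "2 \<le> m" "z \<in> S" and z: "\<And>i. \<bar>z $ i - x $ i\<bar> \<le> h" "\<bar>z $ l - x $ l\<bar> = h"
      and up: "\<And>i. x $ i < z $ i \<longleftrightarrow> x $ i < y $ i"
      and low: "\<And>i. z $ i = x $ i - h \<longleftrightarrow> y $ i = x $ i - m"
    for z l
  proof -
    have "step_toward h x z \<in> S"
    proof (rule less.hyps)
      show "nat h < nat m" "1 \<le> h"
        using that(1) unfolding h_def by linarith+
    qed (use that in auto)
    then show ?thesis
      by (simp add: step_toward_def up low cong: if_cong)
  qed
  consider "m = 1" | "m \<ge> 2" "even m \<or> (\<forall>i. y $ i \<noteq> x $ i - m)"
    | j where "m \<ge> 3" "odd m" "y $ j = x $ j - m"
    using less.prems(4) by (cases "m = 2") (fastforce)+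
  then show ?case
  proof cases
    case 1
    have "step_toward m x y $ i = y $ i" for i
      using bnd[of i] 1 by (auto simp: step_toward_def)
    then have "step_toward m x y = y" by (simp add: vec_eq_iff)
    then show ?thesis using less.prems by simp
  next
    case 2
    show ?thesis
    proof (rule reduce[OF 2(1)])
      show "upper_midpoint x y \<in> S"
        using discrete_midpoint_convex_setD(1)[OF S \<open>x \<in> S\<close> less.prems(1), of k] less.prems 2
        by simp
      fix i
      show "\<bar>upper_midpoint x y $ i - x $ i\<bar> \<le> h"
        using bnd[of i] upper[of i] h by linarith
      show "x $ i < upper_midpoint x y $ i \<longleftrightarrow> x $ i < y $ i"
        using upper[of i] by linarith
      show "upper_midpoint x y $ i = x $ i - h \<longleftrightarrow> y $ i = x $ i - m"
        using 2(2)
      proof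
        assume "even m"
        then show ?thesis
          using bnd[of i] upper[of i] h_even by linarith
      next
        assume "\<forall>i. y $ i \<noteq> x $ i - m"
        then have "y $ i \<noteq> x $ i - m" ..
        then show ?thesis
          using bnd[of i] upper[of i] h by linarith
      qed
    next
      have "even m \<or> y $ k \<noteq> x $ k - m" using 2(2) by auto
      then show "\<bar>upper_midpoint x y $ k - x $ k\<bar> = h"
        using less.prems(3) 2(1) upper[of k] h h_even by (smt (verit))
    qed
  next
    case 3
    let ?y = "lower_midpoint x y"
    define w where "w = decrease_toward x y"
    have w_nth: "w $ i = (if y $ i < x $ i then x $ i - 1 else x $ i)" for i
      by (simp add: w_def decrease_toward_def)
    \<comment> \<open>The strict upper bound required for \<open>decrease_toward_mem\<close> may fail for \<open>y\<close> but holds for the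
      lower midpoint: as \<open>m\<close> is odd, a difference \<open>m\<close> is rounded to \<open>h - 1\<close>, and \<open>-m\<close> to \<open>-h\<close>.\<close>
    have "decrease_toward x ?y \<in> S"
    proof (rule decrease_toward_mem[OF S \<open>x \<in> S\<close>])
      show "?y \<in> S"
        using discrete_midpoint_convex_setD(2)[OF S \<open>x \<in> S\<close> less.prems(1), of j] 3 by simp
      show "x $ i - h \<le> ?y $ i" "?y $ i < x $ i + h" for i
        using bnd[of i] lower[of i] h_odd[OF 3(2)] by linarith+
      show "?y $ j = x $ j - h"
        using 3(3) lower[of j] h_odd[OF 3(2)] by linarith
      show "1 \<le> h" using 3(1) h by linarith
    qed
    moreover have "decrease_toward x ?y = w"
    proof -
      have "?y $ i < x $ i \<longleftrightarrow> y $ i < x $ i" for i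
        using lower[of i] by linarith
      then show ?thesis by (simp add: decrease_toward_def w_def)
    qed
    ultimately have "w \<in> S" by simp
    let ?z = "upper_midpoint w y"
    have z: "if y $ i < x $ i then x $ i + y $ i - 1 \<le> 2 * ?z $ i \<and> 2 * ?z $ i \<le> x $ i + y $ i
      else x $ i + y $ i \<le> 2 * ?z $ i \<and> 2 * ?z $ i \<le> x $ i + y $ i + 1" for i
      using upper_midpoint_bounds[where x = w and y = y and i = i] w_nth[of i] by (auto split: if_splits)
    show ?thesis
    proof (rule reduce)
      show "2 \<le> m" using 3 by simp
      show "?z \<in> S"
        using discrete_midpoint_convex_setD(1)[OF S \<open>w \<in> S\<close> less.prems(1), of j] 3 w_nth[of j] by simp
      fix i
      show "\<bar>?z $ i - x $ i\<bar> \<le> h"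
        using bnd[of i] z[of i] h by (auto split: if_splits)
      show "x $ i < ?z $ i \<longleftrightarrow> x $ i < y $ i"
        using z[of i] by (auto split: if_splits)
      show "?z $ i = x $ i - h \<longleftrightarrow> y $ i = x $ i - m"
        using bnd[of i] z[of i] 3(1) h_odd[OF 3(2)] by (smt (verit))
    next
      show "\<bar>?z $ j - x $ j\<bar> = h"
        using 3(1,3) z[of j] h_odd[OF 3(2)] by (smt (verit))
    qed
  qed
qed

section \<open>The exchange property\<close>

text \<open>
  Induction on the distance \<open>m\<close>. With \<open>y'\<close> the point one step from \<open>y\<close> towards \<open>x\<close>, the step
  from \<open>x\<close> towards \<open>y'\<close> leads to the same point \<open>p\<close>. For \<open>q = x + y' - p\<close> the difference \<open>y - q\<close> is
  the sum of the two steps \<open>p - x\<close> and \<open>y - y'\<close>, which interleave so that they are its upper and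
  lower halves; thus the midpoints of \<open>q\<close> and \<open>y\<close> are \<open>y'\<close> and \<open>x + y - p\<close>.
\<close>

lemma locally_discrete_midpoint_convex_exchange:
  fixes f :: "int ^ 'n \<Rightarrow> ereal" and m :: nat
  assumes fin: "\<And>x. f x \<noteq> -\<infinity>" and f: "locally_discrete_midpoint_convex f"
    and "f x < \<infinity>" "f y < \<infinity>"
    and "\<And>i. \<bar>y $ i - x $ i\<bar> \<le> int m" "\<bar>y $ k - x $ k\<bar> = int m" "2 \<le> m"
  shows "f (step_toward (int m) x y) + f (x + y - step_toward (int m) x y) \<le> f x + f y"
  using assms(7,3-6)
proof (induction m arbitrary: y rule: dec_induct)
  case base
  note bnd = base.prems(3)
  have dist: "dist_inf x y = 2"
    using dist_inf_eq_iff[of x y 2] base.prems by (auto simp: abs_minus_commute)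
  have "upper_midpoint x y $ i = step_toward (int 2) x y $ i"
    "lower_midpoint x y $ i = (x + y - step_toward (int 2) x y) $ i" for i
    using bnd[of i] upper_midpoint_bounds[where x = x and y = y and i = i] lower_midpoint_bounds[where x = x and y = y and i = i]
    by (auto simp: step_toward_def)
  then have "upper_midpoint x y = step_toward (int 2) x y"
    "lower_midpoint x y = x + y - step_toward (int 2) x y"
    by (auto simp: vec_eq_iff)
  then show ?case
    using f dist unfolding locally_discrete_midpoint_convex_def discrete_midpoint_ineq_def by metis
next
  case (step m)
  define M where "M = int m + 1"
  have M: "3 \<le> M" "int (Suc m) = M" "int m = M - 1" using step.hyps by (auto simp: M_def)
  have bnd: "\<bar>y $ i - x $ i\<bar> \<le> M" for i using step.prems(3)[of i] M by simp
  have att: "\<bar>y $ k - x $ k\<bar> = M" using step.prems(4) M by simp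
  have S: "discrete_midpoint_convex_set (eff_dom f)"
    using f by (simp add: locally_discrete_midpoint_convex_def)
  define p where "p = step_toward M x y"
  define y' where "y' = step_toward M y x"
  define q where "q = x + y' - p"
  have p: "p $ i = (if x $ i < y $ i then x $ i + 1
      else if y $ i = x $ i - M then x $ i - 1 else x $ i)" for i
    by (simp add: p_def step_toward_def)
  have y': "y' $ i = (if y $ i < x $ i then y $ i + 1
      else if x $ i = y $ i - M then y $ i - 1 else y $ i)" for i
    by (simp add: y'_def step_toward_def)
  have q: "q $ i = x $ i + y' $ i - p $ i" for i by (simp add: q_def)
  have "y' \<in> eff_dom f"
    unfolding y'_def
    by (rule step_toward_mem[OF S, where k = k])
      (use step.prems bnd att M in \<open>auto simp: eff_dom_def abs_minus_commute\<close>)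
  then have fy': "f y' < \<infinity>" by (simp add: eff_dom_def)
  have "step_toward (int m) x y' $ i = p $ i" for i
    using bnd[of i] M(1) unfolding p step_toward_def vec_lambda_beta y' M(3) by auto
  then have p_eq: "step_toward (int m) x y' = p" by (simp add: vec_eq_iff)
  have IH: "f p + f q \<le> f x + f y'"
    unfolding q_def p_eq[symmetric]
  proof (rule step.IH[OF step.prems(1) fy'])
    show "\<bar>y' $ i - x $ i\<bar> \<le> int m" for i
      using bnd[of i] M(1) unfolding y' M(3) by auto
    show "\<bar>y' $ k - x $ k\<bar> = int m"
      using att M(1) unfolding y' M(3) by auto
  qed
  have "f p < \<infinity>" "f q < \<infinity>"
    using IH fin step.prems(1) fy' by auto
  have diff: "y $ i - q $ i = (if y $ i - x $ i = M then 2 else if x $ i < y $ i then 1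
      else if y $ i = x $ i then 0 else if y $ i - x $ i = - M then -2 else -1)" for i
    using bnd[of i] M(1) unfolding q y' p by auto
  have "\<bar>q $ i - y $ i\<bar> \<le> 2" for i
    using diff[of i] by (auto split: if_splits)
  moreover have "\<bar>q $ k - y $ k\<bar> = 2"
    using diff[of k] att M(1) by (auto split: if_splits)
  ultimately have "dist_inf q y = 2"
    using dist_inf_eq_iff[of q y 2] by auto
  then have "f (upper_midpoint q y) + f (lower_midpoint q y) \<le> f q + f y"
    using f by (auto simp: locally_discrete_midpoint_convex_def discrete_midpoint_ineq_def)
  moreover have "upper_midpoint q y $ i = y' $ i" "lower_midpoint q y $ i = (x + y - p) $ i" for i
  proof -
    have "upper_midpoint q y $ i = q $ i + (y $ i - q $ i + 1) div 2"
      "lower_midpoint q y $ i = q $ i + (y $ i - q $ i) div 2"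
      unfolding upper_midpoint_nth lower_midpoint_nth by presburger+
    moreover have "(y $ i - q $ i + 1) div 2 = p $ i - x $ i"
      "(y $ i - q $ i) div 2 = y $ i - y' $ i"
      using bnd[of i] M(1) unfolding diff p y' by auto
    ultimately show "upper_midpoint q y $ i = y' $ i" "lower_midpoint q y $ i = (x + y - p) $ i"
      by (simp_all add: q)
  qed
  then have "upper_midpoint q y = y'" "lower_midpoint q y = x + y - p"
    by (auto simp: vec_eq_iff)
  ultimately have "f y' + f (x + y - p) \<le> f q + f y" by simp
  \<comment> \<open>Adding the two inequalities, the finite terms \<open>f q\<close> and \<open>f y'\<close> cancel.\<close>
  then have "f p + f (x + y - p) + (f q + f y') \<le> f x + f y + (f q + f y')"
    using add_mono[OF IH, of "f y' + f (x + y - p)" "f q + f y"] by (simp add: ac_simps)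
  moreover have "f q + f y' \<noteq> \<infinity>" "f q + f y' \<noteq> -\<infinity>"
    using \<open>f q < \<infinity>\<close> fy' fin[of q] fin[of y'] by auto
  ultimately have "f p + f (x + y - p) \<le> f x + f y"
    by (auto simp only: ereal_add_le_add_iff2)
  then show ?case unfolding p_def M(2) .
qed

lemma sup_distance_attained:
  fixes x y :: "int ^ 'n"
  obtains k where "\<And>i. \<bar>y $ i - x $ i\<bar> \<le> \<bar>y $ k - x $ k\<bar>"
proof -
  let ?R = "range (\<lambda>i. \<bar>y $ i - x $ i\<bar>)"
  have "Max ?R \<in> ?R" by (rule Max_in) auto
  then obtain k where "Max ?R = \<bar>y $ k - x $ k\<bar>" by (rule imageE)
  moreover have "\<bar>y $ i - x $ i\<bar> \<le> Max ?R" for i by (rule Max_ge) auto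
  ultimately show thesis using that by metis
qed

definition sq_norm :: "int ^ 'n \<Rightarrow> int"
  where "sq_norm z = (\<Sum>i\<in>UNIV. (z $ i)\<^sup>2)"

text \<open>
  A unit step of \<open>x\<close> in direction of the difference \<open>d = y - x\<close>, compensated at \<open>y\<close>, lowers
  \<open>x\<^sup>2 + y\<^sup>2\<close> by \<open>2 (\<bar>d\<bar> - 1)\<close> in each coordinate that moves; the coordinate at distance \<open>m\<close> moves.
\<close>

lemma step_toward_sq_norm_less:
  fixes x y :: "int ^ 'n"
  assumes bnd: "\<And>i. \<bar>y $ i - x $ i\<bar> \<le> m" and att: "\<bar>y $ k - x $ k\<bar> = m" and m: "2 \<le> m"
  shows "sq_norm (step_toward m x y) + sq_norm (x + y - step_toward m x y) < sq_norm x + sq_norm y"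
proof -
  let ?p = "step_toward m x y"
  have diff: "(x $ i)\<^sup>2 + (y $ i)\<^sup>2 - ((?p $ i)\<^sup>2 + ((x + y - ?p) $ i)\<^sup>2)
      = (if x $ i < y $ i then 2 * (y $ i - x $ i - 1)
         else if y $ i = x $ i - m then 2 * (m - 1) else 0)" for i
    by (auto simp: step_toward_def power2_eq_square algebra_simps)
  have nonneg: "0 \<le> (x $ i)\<^sup>2 + (y $ i)\<^sup>2 - ((?p $ i)\<^sup>2 + ((x + y - ?p) $ i)\<^sup>2)" for i
    unfolding diff using m by auto
  have "0 < (x $ k)\<^sup>2 + (y $ k)\<^sup>2 - ((?p $ k)\<^sup>2 + ((x + y - ?p) $ k)\<^sup>2)"
    unfolding diff using m att by auto
  then have "0 < (\<Sum>i\<in>UNIV. (x $ i)\<^sup>2 + (y $ i)\<^sup>2 - ((?p $ i)\<^sup>2 + ((x + y - ?p) $ i)\<^sup>2))"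
    using nonneg by (intro sum_pos2[where i = k]) auto
  then show ?thesis
    unfolding sq_norm_def by (simp add: sum.distrib sum_subtractf)
qed

lemma improving_pair:
  fixes f :: "int ^ 'n \<Rightarrow> ereal"
  assumes fin: "\<And>x. f x \<noteq> -\<infinity>" and f: "locally_discrete_midpoint_convex f"
    and xy: "f x < \<infinity>" "f y < \<infinity>" "2 \<le> \<bar>x $ j - y $ j\<bar>"
  obtains p q where "p + q = x + y" "f p + f q \<le> f x + f y"
    "sq_norm p + sq_norm q < sq_norm x + sq_norm y"
    "\<And>i. min (x $ i) (y $ i) \<le> p $ i \<and> p $ i \<le> max (x $ i) (y $ i)"
    "\<And>i. min (x $ i) (y $ i) \<le> q $ i \<and> q $ i \<le> max (x $ i) (y $ i)"
proof -
  obtain k where k: "\<And>i. \<bar>y $ i - x $ i\<bar> \<le> \<bar>y $ k - x $ k\<bar>"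
    using sup_distance_attained by blast
  define m where "m = \<bar>y $ k - x $ k\<bar>"
  have bnd: "\<bar>y $ i - x $ i\<bar> \<le> m" for i unfolding m_def by (rule k)
  have att: "\<bar>y $ k - x $ k\<bar> = m" by (simp add: m_def)
  have m: "2 \<le> m" using bnd[of j] xy(3) by linarith
  let ?p = "step_toward m x y"
  have between: "min (x $ i) (y $ i) \<le> ?p $ i \<and> ?p $ i \<le> max (x $ i) (y $ i)" for i
    using m by (auto simp: step_toward_def)
  show thesis
  proof (rule that[of ?p "x + y - ?p"])
    show "f ?p + f (x + y - ?p) \<le> f x + f y"
      using locally_discrete_midpoint_convex_exchange[OF fin f xy(1,2), of "nat m" k] bnd att m
      by simp
    show "sq_norm ?p + sq_norm (x + y - ?p) < sq_norm x + sq_norm y"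
      by (rule step_toward_sq_norm_less[OF bnd att m])
    show "min (x $ i) (y $ i) \<le> (x + y - ?p) $ i \<and> (x + y - ?p) $ i \<le> max (x $ i) (y $ i)" for i
      using between[of i] by auto
  qed (use between in auto)
qed

section \<open>Convex combinations of integer points\<close>

lemma finite_vec_box:
  fixes A :: "'n::finite \<Rightarrow> 'a set"
  assumes "\<And>i. finite (A i)"
  shows "finite {z :: 'a ^ 'n. \<forall>i. z $ i \<in> A i}"
proof (rule finite_imageD)
  show "finite (vec_nth ` {z :: 'a ^ 'n. \<forall>i. z $ i \<in> A i})"
    by (rule finite_subset[OF _ finite_PiE[of UNIV A]]) (use assms in auto)
  show "inj_on vec_nth {z :: 'a ^ 'n. \<forall>i. z $ i \<in> A i}"
    by (auto simp: inj_on_def vec_eq_iff)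
qed

lemma finite_int_nbhd: "finite (int_nbhd x)"
proof (rule finite_subset)
  show "int_nbhd x \<subseteq> {z. \<forall>i. z $ i \<in> {\<lfloor>x $ i\<rfloor> .. \<lceil>x $ i\<rceil>}}"
  proof (clarsimp simp: int_nbhd_def)
    fix z i assume "\<forall>i. \<bar>x $ i - real_of_int (z $ i)\<bar> < 1"
    then have "\<bar>x $ i - real_of_int (z $ i)\<bar> < 1" ..
    then show "\<lfloor>x $ i\<rfloor> \<le> z $ i \<and> z $ i \<le> \<lceil>x $ i\<rceil>" by linarith
  qed
qed (rule finite_vec_box, simp)

text \<open>
  Weight \<open>\<delta>\<close> is taken from each of \<open>x\<close> and \<open>y\<close> and given to each of \<open>p\<close> and \<open>q\<close>.
  The points \<open>p\<close> and \<open>q\<close> may coincide with each other or with \<open>x\<close> or \<open>y\<close>.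
\<close>

lemma convex_hull_transfer:
  fixes \<phi> :: "'a \<Rightarrow> 'b::real_vector"
  assumes "finite B" and u: "\<And>z. z \<in> B \<Longrightarrow> 0 \<le> u z" "sum u B = 1"
    and mem: "x \<in> B" "y \<in> B" "p \<in> B" "q \<in> B" and "x \<noteq> y"
    and \<delta>: "0 \<le> \<delta>" "\<delta> \<le> u x" "\<delta> \<le> u y"
  shows "(\<Sum>z\<in>B. u z *\<^sub>R \<phi> z) + \<delta> *\<^sub>R (\<phi> p + \<phi> q - \<phi> x - \<phi> y) \<in> convex hull (\<phi> ` B)"
proof -
  define v where "v z = u z + ((if z = p then \<delta> else 0) + (if z = q then \<delta> else 0)
    - (if z = x then \<delta> else 0) - (if z = y then \<delta> else 0))" for z
  have pick: "(\<Sum>z\<in>B. (if z = t then \<delta> else 0) *\<^sub>R \<phi> z) = \<delta> *\<^sub>R \<phi> t" if "t \<in> B" for t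
  proof -
    have "(if z = t then \<delta> else 0) *\<^sub>R \<phi> z = (if z = t then \<delta> *\<^sub>R \<phi> z else 0)" for z
      by simp
    then show ?thesis using \<open>finite B\<close> that by simp
  qed
  have "(\<Sum>z\<in>B. v z *\<^sub>R \<phi> z)
      = (\<Sum>z\<in>B. u z *\<^sub>R \<phi> z) + \<delta> *\<^sub>R (\<phi> p + \<phi> q - \<phi> x - \<phi> y)"
    using mem
    by (simp only: v_def scaleR_add_left scaleR_diff_left sum.distrib sum_subtractf pick
        scaleR_add_right scaleR_diff_right)
  moreover have "(\<Sum>z\<in>B. v z *\<^sub>R \<phi> z) \<in> convex hull (\<phi> ` B)"
  proof (rule convex_sum)
    show "sum v B = 1"
      using \<open>finite B\<close> mem u(2) by (simp add: v_def sum.distrib sum_subtractf)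
    show "0 \<le> v z" if "z \<in> B" for z
      using that u(1)[of z] \<delta> \<open>x \<noteq> y\<close> by (auto simp: v_def)
  qed (use \<open>finite B\<close> in \<open>auto intro: hull_inc\<close>)
  ultimately show ?thesis by simp
qed

lemma convex_hull_image_weights:
  fixes \<phi> :: "'a \<Rightarrow> 'b::real_vector"
  assumes "finite B" "inj_on \<phi> B" "b \<in> convex hull (\<phi> ` B)"
  obtains u where "\<And>z. z \<in> B \<Longrightarrow> 0 \<le> u z" "sum u B = (1::real)" "(\<Sum>z\<in>B. u z *\<^sub>R \<phi> z) = b"
proof -
  obtain v where "\<forall>s\<in>\<phi> ` B. 0 \<le> v s" "sum v (\<phi> ` B) = 1" "(\<Sum>s\<in>\<phi> ` B. v s *\<^sub>R s) = b"
    using assms(1,3) by (auto simp: convex_hull_finite)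
  then show thesis
    using assms(2) by (intro that[of "v \<circ> \<phi>"]) (auto simp: sum.reindex)
qed

text \<open>
  In each coordinate the barycentre deviates from \<open>z\<close> by an average of deviations of size at most
  one, in which \<open>z\<close> itself contributes zero with positive weight. This makes the bound strict.
\<close>

lemma mem_int_nbhd_of_clustered:
  assumes "finite B" and u: "\<And>z. z \<in> B \<Longrightarrow> 0 \<le> u z" "sum u B = 1"
    and "z \<in> B" "0 < u z"
    and close: "\<And>w i. w \<in> B \<Longrightarrow> 0 < u w \<Longrightarrow> \<bar>w $ i - z $ i\<bar> \<le> 1"
  shows "z \<in> int_nbhd (\<Sum>w\<in>B. u w *\<^sub>R real_vec w)"
proof -
  have "\<bar>(\<Sum>w\<in>B. u w *\<^sub>R real_vec w) $ i - real_of_int (z $ i)\<bar> < 1" for i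
  proof -
    have "(\<Sum>w\<in>B. u w *\<^sub>R real_vec w) $ i - real_of_int (z $ i)
        = (\<Sum>w\<in>B. u w * real_of_int (w $ i)) - (\<Sum>w\<in>B. u w) * real_of_int (z $ i)"
      by (simp add: u(2))
    also have "\<dots> = (\<Sum>w\<in>B. u w * real_of_int (w $ i - z $ i))"
      by (simp add: sum_distrib_right sum_subtractf algebra_simps)
    also have "\<bar>\<dots>\<bar> \<le> (\<Sum>w\<in>B. \<bar>u w * real_of_int (w $ i - z $ i)\<bar>)"
      by (rule sum_abs)
    also have "\<dots> < sum u B"
    proof (rule sum_strict_mono_ex1)
      show "\<forall>w\<in>B. \<bar>u w * real_of_int (w $ i - z $ i)\<bar> \<le> u w"
      proof
        fix w assume w: "w \<in> B"
        show "\<bar>u w * real_of_int (w $ i - z $ i)\<bar> \<le> u w"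
        proof (cases "u w = 0")
          case False
          then have "0 < u w" using u(1)[OF w] by simp
          then have "real_of_int \<bar>w $ i - z $ i\<bar> \<le> 1"
            using close[OF w, of i] by linarith
          then have "u w * real_of_int \<bar>w $ i - z $ i\<bar> \<le> u w * 1"
            using \<open>0 < u w\<close> by (intro mult_left_mono) auto
          then show ?thesis using \<open>0 < u w\<close> by (simp add: abs_mult)
        qed simp
      qed
      show "\<exists>w\<in>B. \<bar>u w * real_of_int (w $ i - z $ i)\<bar> < u w"
        using \<open>z \<in> B\<close> \<open>0 < u z\<close> by (intro bexI[of _ z]) auto
    qed (rule \<open>finite B\<close>)
    finally show ?thesis by (simp add: u(2))
  qed
  then show ?thesis by (simp add: int_nbhd_def)
qed

lemma local_convex_ext_le_clustered:
  fixes f :: "int ^ 'n \<Rightarrow> ereal"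
  assumes fin: "\<And>x. f x \<noteq> -\<infinity>"
    and "finite B" "B \<subseteq> eff_dom f" and u: "\<And>z. z \<in> B \<Longrightarrow> 0 \<le> u z" "sum u B = 1"
    and close: "\<And>z w i. z \<in> B \<Longrightarrow> 0 < u z \<Longrightarrow> w \<in> B \<Longrightarrow> 0 < u w \<Longrightarrow> \<bar>w $ i - z $ i\<bar> \<le> 1"
  shows "local_convex_ext f (\<Sum>z\<in>B. u z *\<^sub>R real_vec z)
    \<le> ereal (\<Sum>z\<in>B. u z * real_of_ereal (f z))"
proof -
  let ?p = "\<Sum>z\<in>B. u z *\<^sub>R real_vec z"
  define c where "c z = (if z \<in> B then u z else 0)" for z
  have nbhd: "z \<in> int_nbhd ?p" if "z \<in> B" "u z \<noteq> 0" for z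
    using mem_int_nbhd_of_clustered[OF \<open>finite B\<close> u, of z] close[of z] u(1)[of z] that by force
  have transfer: "(\<Sum>z\<in>int_nbhd ?p. c z *\<^sub>R h z) = (\<Sum>z\<in>B. u z *\<^sub>R h z)"
    for h :: "int ^ 'n \<Rightarrow> 'b::real_vector"
    by (rule sum.mono_neutral_cong)
      (use nbhd finite_int_nbhd \<open>finite B\<close> in \<open>auto simp: c_def\<close>)
  have "c \<in> nbhd_coeffs ?p"
    unfolding nbhd_coeffs_def
    using transfer[of real_vec] transfer[of "\<lambda>_. 1 :: real"] u by (simp add: c_def)
  then have "local_convex_ext f ?p \<le> (\<Sum>z\<in>int_nbhd ?p. ereal (c z) * f z)"
    unfolding local_convex_ext_def by (rule INF_lower)
  also have "\<dots> = (\<Sum>z\<in>int_nbhd ?p. ereal (c z *\<^sub>R real_of_ereal (f z)))"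
  proof (rule sum.cong)
    fix z
    show "ereal (c z) * f z = ereal (c z *\<^sub>R real_of_ereal (f z))"
    proof (cases "z \<in> B")
      case True
      then have "f z \<noteq> \<infinity>" using \<open>B \<subseteq> eff_dom f\<close> by (auto simp: eff_dom_def)
      then show ?thesis using fin[of z] by (cases "f z") auto
    qed (simp add: c_def flip: zero_ereal_def)
  qed simp
  also have "\<dots> = ereal (\<Sum>z\<in>B. u z * real_of_ereal (f z))"
    using transfer[of "\<lambda>z. real_of_ereal (f z)"] by (simp add: sum_ereal)
  finally show ?thesis .
qed

section \<open>The local extension is bounded by every convex combination\<close>

text \<open>
  Each integer point is lifted by \<open>\<phi>\<close> to the triple of its position, its value and its square norm,
  so that minimising over convex combinations becomes minimising over the convex hull of a finite
  set, which is compact. The box is chosen to contain the given points; since exchanges stay between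
  the two points that they start from, they do not leave it.
\<close>

lemma local_convex_ext_le_combination:
  fixes f :: "int ^ 'n \<Rightarrow> ereal"
  assumes fin: "\<And>x. f x \<noteq> -\<infinity>" and f: "locally_discrete_midpoint_convex f"
    and D: "finite D" "D \<subseteq> eff_dom f" and w: "\<And>z. z \<in> D \<Longrightarrow> 0 \<le> w z" "sum w D = 1"
  shows "local_convex_ext f (\<Sum>z\<in>D. w z *\<^sub>R real_vec z)
    \<le> ereal (\<Sum>z\<in>D. w z * real_of_ereal (f z))"
proof -
  define K where "K = (\<Sum>z\<in>D. \<Sum>i\<in>UNIV. \<bar>z $ i\<bar>)"
  define B where "B = eff_dom f \<inter> {z. \<forall>i. z $ i \<in> {-K..K}}"
  have "finite B"
    unfolding B_def by (intro finite_Int disjI2 finite_vec_box) simp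
  have B_dom: "B \<subseteq> eff_dom f" by (simp add: B_def)
  have "D \<subseteq> B"
  proof
    fix z assume z: "z \<in> D"
    have "\<bar>z $ i\<bar> \<le> K" for i
    proof -
      have "\<bar>z $ i\<bar> \<le> (\<Sum>i\<in>UNIV. \<bar>z $ i\<bar>)" by (rule member_le_sum) auto
      also have "\<dots> \<le> K"
        unfolding K_def using z D by (intro member_le_sum) (auto intro: sum_nonneg)
      finally show ?thesis .
    qed
    then show "z \<in> B" using z D by (auto simp: B_def abs_le_iff minus_le_iff)
  qed
  define r where "r z = real_of_ereal (f z)" for z
  have f_eq: "f z = ereal (r z)" if "z \<in> eff_dom f" for z
    using that fin[of z] by (cases "f z") (auto simp: r_def eff_dom_def)
  define \<phi> where "\<phi> z = (real_vec z, r z, real_of_int (sq_norm z))" for z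
  have inj: "inj_on \<phi> B"
    by (auto simp: inj_on_def \<phi>_def real_vec_def vec_eq_iff)
  define H where "H = convex hull (\<phi> ` B)"
  define p where "p = (\<Sum>z\<in>D. w z *\<^sub>R real_vec z)"
  define start where "start = (\<Sum>z\<in>D. w z *\<^sub>R \<phi> z)"
  have position_sum: "fst (\<Sum>z\<in>A. v z *\<^sub>R \<phi> z) = (\<Sum>z\<in>A. v z *\<^sub>R real_vec z)"
    and cost_sum: "fst (snd (\<Sum>z\<in>A. v z *\<^sub>R \<phi> z)) = (\<Sum>z\<in>A. v z * r z)" for A and v :: "_ \<Rightarrow> real"
    by (simp_all add: fst_sum snd_sum \<phi>_def)
  have "start \<in> H"
    unfolding start_def H_def
    by (rule convex_sum) (use D w \<open>D \<subseteq> B\<close> in \<open>auto intro!: hull_inc\<close>)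
  \<comment> \<open>Lexicographic minimisation over the barycentre \<open>p\<close>: \<open>a\<close> has least value, and \<open>b\<close> has least
    square norm among the points with that value.\<close>
  define H1 where "H1 = H \<inter> {v. fst v = p}"
  have "compact H"
    unfolding H_def using \<open>finite B\<close> by (intro finite_imp_compact_convex_hull) simp
  moreover have "closed {v :: (real ^ 'n) \<times> real \<times> real. fst v = p}"
    by (intro closed_Collect_eq continuous_intros)
  ultimately have "compact H1" unfolding H1_def by (rule compact_Int_closed)
  have "start \<in> H1"
    using \<open>start \<in> H\<close> by (simp add: H1_def start_def position_sum p_def)
  have "continuous_on H1 (\<lambda>v. fst (snd v))" by (intro continuous_intros)
  then obtain a where a: "a \<in> H1" "\<And>v. v \<in> H1 \<Longrightarrow> fst (snd a) \<le> fst (snd v)"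
    using continuous_attains_inf[OF \<open>compact H1\<close>, of "\<lambda>v. fst (snd v)"] \<open>start \<in> H1\<close> by blast
  define H2 where "H2 = H1 \<inter> {v. fst (snd v) = fst (snd a)}"
  have "closed {v :: (real ^ 'n) \<times> real \<times> real. fst (snd v) = fst (snd a)}"
    by (intro closed_Collect_eq continuous_intros)
  then have "compact H2" unfolding H2_def using \<open>compact H1\<close> by (intro compact_Int_closed)
  moreover have "a \<in> H2" using a by (simp add: H2_def)
  moreover have "continuous_on H2 (\<lambda>v. snd (snd v))" by (intro continuous_intros)
  ultimately obtain b where b: "b \<in> H2" "\<And>v. v \<in> H2 \<Longrightarrow> snd (snd b) \<le> snd (snd v)"
    using continuous_attains_inf[of H2 "\<lambda>v. snd (snd v)"] by blast
  have b_H: "b \<in> H" "fst b = p" "fst (snd b) = fst (snd a)"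
    using b(1) by (auto simp: H2_def H1_def)
  obtain u where u: "\<And>z. z \<in> B \<Longrightarrow> 0 \<le> u z" "sum u B = 1" "(\<Sum>z\<in>B. u z *\<^sub>R \<phi> z) = b"
    using convex_hull_image_weights[OF \<open>finite B\<close> inj] b_H(1) unfolding H_def by blast
  have close: "\<bar>y $ i - x $ i\<bar> \<le> 1" if xy: "x \<in> B" "0 < u x" "y \<in> B" "0 < u y" for x y i
  proof (rule ccontr)
    assume far: "\<not> \<bar>y $ i - x $ i\<bar> \<le> 1"
    have "f x < \<infinity>" "f y < \<infinity>" using xy B_dom by (auto simp: eff_dom_def)
    moreover have "2 \<le> \<bar>x $ i - y $ i\<bar>" using far by linarith
    ultimately obtain s t where st: "s + t = x + y" "f s + f t \<le> f x + f y"
      "sq_norm s + sq_norm t < sq_norm x + sq_norm y"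
      "\<And>i. min (x $ i) (y $ i) \<le> s $ i \<and> s $ i \<le> max (x $ i) (y $ i)"
      "\<And>i. min (x $ i) (y $ i) \<le> t $ i \<and> t $ i \<le> max (x $ i) (y $ i)"
      using improving_pair[OF fin f] by metis
    have "f s < \<infinity>" "f t < \<infinity>"
      using st(2) \<open>f x < \<infinity>\<close> \<open>f y < \<infinity>\<close> fin by auto
    moreover have "z $ l \<in> {-K..K}"
      if "min (x $ l) (y $ l) \<le> z $ l \<and> z $ l \<le> max (x $ l) (y $ l)" for z l
    proof -
      have "x $ l \<in> {-K..K}" "y $ l \<in> {-K..K}" using xy by (auto simp: B_def)
      then show ?thesis using that by auto
    qed
    ultimately have "s \<in> B" "t \<in> B"
      using st(4,5) by (auto simp: B_def eff_dom_def)
    define \<delta> where "\<delta> = min (u x) (u y)"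
    have \<delta>: "0 < \<delta>" "\<delta> \<le> u x" "\<delta> \<le> u y" using xy by (auto simp: \<delta>_def)
    define v where "v = b + \<delta> *\<^sub>R (\<phi> s + \<phi> t - \<phi> x - \<phi> y)"
    have "v \<in> H"
      unfolding v_def H_def u(3)[symmetric]
      by (rule convex_hull_transfer)
        (use u \<open>finite B\<close> xy \<open>s \<in> B\<close> \<open>t \<in> B\<close> \<delta> far in auto)
    moreover have "real_vec s + real_vec t = real_vec x + real_vec y"
      using st(1) by (simp flip: real_vec_add)
    then have "fst v = p"
      using b_H by (simp add: v_def \<phi>_def algebra_simps)
    ultimately have "v \<in> H1" by (simp add: H1_def)
    have "r s + r t \<le> r x + r y"
      using st(2) f_eq xy \<open>s \<in> B\<close> \<open>t \<in> B\<close> B_dom by (simp add: subset_iff)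
    then have "\<delta> * (r s + r t - r x - r y) \<le> 0"
      using \<delta> by (intro mult_nonneg_nonpos) auto
    then have "fst (snd v) \<le> fst (snd b)"
      by (simp add: v_def \<phi>_def)
    then have "v \<in> H2"
      using a(2)[OF \<open>v \<in> H1\<close>] \<open>v \<in> H1\<close> b_H by (simp add: H2_def)
    have "real_of_int (sq_norm s) + sq_norm t < real_of_int (sq_norm x) + sq_norm y"
      using st(3) by linarith
    then have "\<delta> * (real_of_int (sq_norm s) + sq_norm t - sq_norm x - sq_norm y) < 0"
      using \<delta> by (intro mult_pos_neg) auto
    then have "snd (snd v) < snd (snd b)"
      by (simp add: v_def \<phi>_def)
    then show False using b(2)[OF \<open>v \<in> H2\<close>] by simp
  qed
  have "p = (\<Sum>z\<in>B. u z *\<^sub>R real_vec z)"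
    using position_sum[of u B] u(3) b_H by simp
  then have "local_convex_ext f p \<le> ereal (\<Sum>z\<in>B. u z * r z)"
    unfolding r_def
    using local_convex_ext_le_clustered[OF fin \<open>finite B\<close> B_dom u(1,2) close] by simp
  also have "(\<Sum>z\<in>B. u z * r z) = fst (snd b)"
    using cost_sum[of u B] u(3) by simp
  also have "\<dots> \<le> (\<Sum>z\<in>D. w z * r z)"
    using a(2)[OF \<open>start \<in> H1\<close>] b_H(3) by (simp add: start_def cost_sum)
  finally show ?thesis by (simp add: p_def r_def)
qed

section \<open>Convexity of the local extension\<close>

text \<open>This excludes an indeterminate sum of opposite infinities in the convexity inequality.\<close>

lemma local_convex_ext_not_MInf:
  assumes fin: "\<And>x. f x \<noteq> -\<infinity>"
  shows "local_convex_ext f x \<noteq> -\<infinity>"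
proof -
  \<comment> \<open>Infinite values of \<open>f\<close> are turned into \<open>0\<close> by \<open>real_of_ereal\<close>, which is still a lower bound.\<close>
  define K where "K = Min (insert 0 ((\<lambda>z. real_of_ereal (f z)) ` int_nbhd x))"
  have K: "ereal K \<le> f z" if "z \<in> int_nbhd x" for z
  proof -
    have "K \<le> real_of_ereal (f z)"
      unfolding K_def using that finite_int_nbhd[of x] by (intro Min_le) auto
    then show ?thesis using fin[of z] by (cases "f z") auto
  qed
  have "ereal K \<le> local_convex_ext f x"
    unfolding local_convex_ext_def
  proof (rule INF_greatest)
    fix c assume c: "c \<in> nbhd_coeffs x"
    have "ereal K = (\<Sum>z\<in>int_nbhd x. ereal (c z * K))"
      using c by (simp add: sum_ereal nbhd_coeffs_def flip: sum_distrib_right)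
    also have "\<dots> = (\<Sum>z\<in>int_nbhd x. ereal (c z) * ereal K)"
      by simp
    also have "\<dots> \<le> (\<Sum>z\<in>int_nbhd x. ereal (c z) * f z)"
      using c by (intro sum_mono ereal_mult_left_mono K) (auto simp: nbhd_coeffs_def)
    finally show "ereal K \<le> (\<Sum>z\<in>int_nbhd x. ereal (c z) * f z)" .
  qed
  then show ?thesis by auto
qed

lemma local_convex_ext_less_witness:
  assumes fin: "\<And>x. f x \<noteq> -\<infinity>" and less: "local_convex_ext f x < ereal a"
  obtains D w where "finite D" "D \<subseteq> eff_dom f" "\<And>z. z \<in> D \<Longrightarrow> 0 \<le> w z" "sum w D = 1"
    "(\<Sum>z\<in>D. w z *\<^sub>R real_vec z) = x" "(\<Sum>z\<in>D. w z * real_of_ereal (f z)) < a"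
proof -
  from less obtain c where c: "c \<in> nbhd_coeffs x"
    and cost: "(\<Sum>z\<in>int_nbhd x. ereal (c z) * f z) < ereal a"
    unfolding local_convex_ext_def INF_less_iff by blast
  define D where "D = {z \<in> int_nbhd x. c z \<noteq> 0}"
  have pos: "0 < c z" if "z \<in> D" for z
    using c that by (force simp: nbhd_coeffs_def D_def)
  have "finite D" using finite_int_nbhd[of x] by (simp add: D_def)
  have transfer: "(\<Sum>z\<in>int_nbhd x. c z *\<^sub>R h z) = (\<Sum>z\<in>D. c z *\<^sub>R h z)"
    for h :: "_ \<Rightarrow> 'b::real_vector"
    by (rule sum.mono_neutral_right) (auto simp: D_def finite_int_nbhd)
  have cost_D: "(\<Sum>z\<in>int_nbhd x. ereal (c z) * f z) = (\<Sum>z\<in>D. ereal (c z) * f z)"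
    by (rule sum.mono_neutral_right) (auto simp: D_def finite_int_nbhd simp flip: zero_ereal_def)
  have "f z \<noteq> \<infinity>" if "z \<in> D" for z
  proof
    assume "f z = \<infinity>"
    then have "ereal (c z) * f z = \<infinity>" using pos[OF that] by simp
    then have "(\<Sum>z\<in>D. ereal (c z) * f z) = \<infinity>"
      using \<open>finite D\<close> that by (subst sum_Pinfty) auto
    then show False using cost cost_D by simp
  qed
  then have dom: "D \<subseteq> eff_dom f" by (auto simp: eff_dom_def)
  have "ereal (c z) * f z = ereal (c z * real_of_ereal (f z))" if "z \<in> D" for z
    using that dom fin[of z] by (cases "f z") (auto simp: eff_dom_def)
  then have "(\<Sum>z\<in>D. ereal (c z) * f z) = ereal (\<Sum>z\<in>D. c z * real_of_ereal (f z))"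
    by (simp add: sum_ereal)
  then have "(\<Sum>z\<in>D. c z * real_of_ereal (f z)) < a"
    using cost cost_D by simp
  moreover have "sum c D = 1" "(\<Sum>z\<in>D. c z *\<^sub>R real_vec z) = x"
    using c transfer[of real_vec] transfer[of "\<lambda>_. 1 :: real"] by (simp_all add: nbhd_coeffs_def)
  ultimately show thesis
    using \<open>finite D\<close> dom pos by (intro that[of D c]) (auto intro: less_imp_le)
qed

text \<open>
  If both values are finite, near-optimal combinations for \<open>x\<close> and \<open>y\<close>, mixed with weights \<open>u\<close> and
  \<open>v\<close>, form a combination for \<open>u *\<^sub>R x + v *\<^sub>R y\<close>, whose points may be far apart. Its cost still
  bounds the local extension.
\<close>

lemma locally_discrete_midpoint_convex_imp_integrally_convex:
  fixes f :: "int ^ 'n \<Rightarrow> ereal"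
  assumes fin: "\<And>x. f x \<noteq> -\<infinity>" and f: "locally_discrete_midpoint_convex f"
  shows "integrally_convex f"
  unfolding integrally_convex_def ereal_convex_def
proof (intro allI impI)
  let ?g = "local_convex_ext f"
  fix x y :: "real ^ 'n" and u v :: real
  assume uv: "0 \<le> u" "0 \<le> v" "u + v = 1"
  show "?g (u *\<^sub>R x + v *\<^sub>R y) \<le> ereal u * ?g x + ereal v * ?g y"
  proof (cases "u = 0 \<or> v = 0 \<or> ?g x = \<infinity> \<or> ?g y = \<infinity>")
    case True
    have "?g x \<noteq> -\<infinity>" "?g y \<noteq> -\<infinity>"
      using local_convex_ext_not_MInf[of f, OF fin] by auto
    with True uv show ?thesis
      by (cases "?g x"; cases "?g y") (auto simp flip: zero_ereal_def one_ereal_def)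
  next
    case False
    then obtain a b where ab: "?g x = ereal a" "?g y = ereal b"
      using local_convex_ext_not_MInf[of f, OF fin] by (meson ereal_cases)
    have "?g (u *\<^sub>R x + v *\<^sub>R y) \<le> ereal (u * a + v * b) + ereal e" if "0 < e" for e
    proof -
      have less: "?g x < ereal (a + e)" "?g y < ereal (b + e)"
        using ab that by auto
      obtain D1 w1 where
        1: "finite D1" "D1 \<subseteq> eff_dom f" "\<And>z. z \<in> D1 \<Longrightarrow> 0 \<le> w1 z" "sum w1 D1 = 1"
          "(\<Sum>z\<in>D1. w1 z *\<^sub>R real_vec z) = x" "(\<Sum>z\<in>D1. w1 z * real_of_ereal (f z)) < a + e"
        using local_convex_ext_less_witness[OF fin less(1)] by blast
      obtain D2 w2 where
        2: "finite D2" "D2 \<subseteq> eff_dom f" "\<And>z. z \<in> D2 \<Longrightarrow> 0 \<le> w2 z" "sum w2 D2 = 1"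
          "(\<Sum>z\<in>D2. w2 z *\<^sub>R real_vec z) = y" "(\<Sum>z\<in>D2. w2 z * real_of_ereal (f z)) < b + e"
        using local_convex_ext_less_witness[OF fin less(2)] by blast
      define w where "w z = u * (if z \<in> D1 then w1 z else 0) + v * (if z \<in> D2 then w2 z else 0)" for z
      have mix: "(\<Sum>z\<in>D1 \<union> D2. w z *\<^sub>R h z)
          = u *\<^sub>R (\<Sum>z\<in>D1. w1 z *\<^sub>R h z) + v *\<^sub>R (\<Sum>z\<in>D2. w2 z *\<^sub>R h z)"
        for h :: "_ \<Rightarrow> 'b::real_vector"
      proof -
        have "(\<Sum>z\<in>D1 \<union> D2. (if z \<in> D1 then w1 z else 0) *\<^sub>R h z) = (\<Sum>z\<in>D1. w1 z *\<^sub>R h z)"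
          "(\<Sum>z\<in>D1 \<union> D2. (if z \<in> D2 then w2 z else 0) *\<^sub>R h z) = (\<Sum>z\<in>D2. w2 z *\<^sub>R h z)"
          using 1(1) 2(1) by (auto intro!: sum.mono_neutral_cong_right)
        then show ?thesis
          by (simp add: w_def scaleR_add_left sum.distrib flip: scaleR_scaleR scaleR_sum_right)
      qed
      have "?g (\<Sum>z\<in>D1 \<union> D2. w z *\<^sub>R real_vec z)
          \<le> ereal (\<Sum>z\<in>D1 \<union> D2. w z * real_of_ereal (f z))"
      proof (rule local_convex_ext_le_combination[OF fin f])
        show "0 \<le> w z" for z
          using 1(3) 2(3) uv by (simp add: w_def)
        show "sum w (D1 \<union> D2) = 1"
          using mix[of "\<lambda>_. 1 :: real"] 1(4) 2(4) uv by simp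
      qed (use 1 2 in auto)
      also have "(\<Sum>z\<in>D1 \<union> D2. w z *\<^sub>R real_vec z) = u *\<^sub>R x + v *\<^sub>R y"
        unfolding mix 1(5) 2(5) ..
      also have "(\<Sum>z\<in>D1 \<union> D2. w z * real_of_ereal (f z)) \<le> u * (a + e) + v * (b + e)"
        using mix[of "\<lambda>z. real_of_ereal (f z)"] 1(6) 2(6) uv
        by (simp add: add_mono mult_left_mono)
      also have "u * (a + e) + v * (b + e) = u * a + v * b + (u + v) * e"
        by (simp add: algebra_simps)
      finally show ?thesis using uv by simp
    qed
    then have "?g (u *\<^sub>R x + v *\<^sub>R y) \<le> ereal (u * a + v * b)"
      using ereal_le_epsilon2 by blast
    then show ?thesis by (simp add: ab)
  qed
qed

theorem theorem2p10:
  fixes f :: "int ^ 'n \<Rightarrow> ereal"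
  assumes "\<And>x. f x \<noteq> -\<infinity>"
  shows "(L_natural_convex f \<longrightarrow> globally_discrete_midpoint_convex f) \<and>
         (globally_discrete_midpoint_convex f \<longrightarrow> locally_discrete_midpoint_convex f) \<and>
         (locally_discrete_midpoint_convex f \<longrightarrow> integrally_convex f)"
proof (intro conjI impI)
  show "globally_discrete_midpoint_convex f" if "L_natural_convex f"
    using L_natural_convex_midpoint[OF that] by (simp add: globally_discrete_midpoint_convex_def)
  show "locally_discrete_midpoint_convex f" if "globally_discrete_midpoint_convex f"
    using globally_imp_locally_discrete_midpoint_convex[of f] assms that by blast
  show "integrally_convex f" if "locally_discrete_midpoint_convex f"
    using locally_discrete_midpoint_convex_imp_integrally_convex[of f] assms that by blast
qed

end
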